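(* Let $\alpha,\gamma,\alpha',\gamma'\in(0,1)$ with $\rho:=\alpha-\gamma>0$ and $\rho':=\alpha'-\gamma'>0$. Consider two Volterra paths $z\in\mathcal V^{(\alpha,\gamma)}(\Delta_2;E)$ and $y\in\mathcal V^{(\alpha',\gamma')}(\Delta_2;E)$ (spaces defined in the context). Then the convolution product, given by $$z^{\tau}_{tu}\ast y^{\cdot}_{us}=\int_{t>r>u}dz^{\tau}_r\otimes y^{r}_{us}:=\lim_{|\mathcal P|\to0}\sum_{[u',v']\in\mathcal P}z^{\tau}_{v'u'}\otimes y^{u'}_{us},$$ where $\mathcal P$ ranges over the partitions of $[u,t]$ with mesh $|\mathcal P|\to0$, is a well-defined bilinear operation (the limit exists, as a Volterra–Young integral) for all $(s,u,t,\tau)\in\Delta_4$. Moreover, $$|z^{\tau}_{tu}\ast y^{\cdot}_{us}|\lesssim\|z\|_{(\alpha,\gamma),1}\,\|y\|_{(\alpha',\gamma'),1,2}\left[(\tau-t)^{-\gamma}(t-s)^{\rho+\rho'+\gamma}\wedge(\tau-s)^{\rho+\rho'}\right].$$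
   Context: Fix $T>0$ and a Banach space $E$ (with a tensor norm satisfying $|a\otimes b|\le|a||b|$). $\Delta_n=\Delta_n([0,T])=\{(x_1,\dots,x_n)\in[0,T]^n:\ 0\le x_1<\cdots<x_n\le T\}$. $a\lesssim b$ means $a\le Cb$ for some constant $C>0$ independent of the time variables and of $z,y$. For $z:\Delta_2\to E$, $(t,\tau)\mapsto z^{\tau}_t$ ($t\le\tau$), write $z^{\tau}_{ts}=z^{\tau}_t-z^{\tau}_s$, $z^{\tau\tau'}_s=z^{\tau}_s-z^{\tau'}_s$ and $z^{\tau\tau'}_{ts}=z^{\tau\tau'}_t-z^{\tau\tau'}_s$. With $\rho=\alpha-\gamma$ set $$\|z\|_{(\alpha,\gamma),1}=\sup_{(s,t,\tau)\in\Delta_3}\frac{|z^{\tau}_{ts}|}{|\tau-t|^{-\gamma}|t-s|^{\alpha}\wedge|\tau-s|^{\rho}},$$ $$\|z\|_{(\alpha,\gamma),1,2}=\sup_{\substack{(s,t,\tau',\tau)\in\Delta_4\\ \eta\in[0,1],\,\zeta\in[0,\rho)}}\frac{|z^{\tau\tau'}_{ts}|}{|\tau-\tau'|^{\eta}|\tau'-t|^{-\eta+\zeta}\left(|\tau'-t|^{-\gamma-\zeta}|t-s|^{\alpha}\wedge|\tau'-s|^{\rho-\zeta}\right)},$$ and $\|z\|_{(\alpha,\gamma)}=\|z\|_{(\alpha,\gamma),1}+\|z\|_{(\alpha,\gamma),1,2}$. The space $\mathcal V^{(\alpha,\gamma)}(\Delta_2;E)$ of Volterra paths consists of all $z:\Delta_2\to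 E$ such that: for every $\tau$, $t\mapsto z^{\tau}_t\in\mathcal C^{\alpha-\gamma}(\{\tau\})\cap\mathcal C^{\alpha}([0,\tau))$; for every $t$, $\tau\mapsto z^{\tau}_t\in\mathcal C^{\alpha-\gamma}(\{t\})\cap\mathcal C^{1}((t,T])$; $z^{\tau}_0=z_0\in E$ for all $\tau\in(0,T]$; and $\|z\|_{(\alpha,\gamma)}<\infty$. Here $\mathcal C^{a}(\{t\})$ is the set of functions $f$ defined in a neighbourhood $V_t$ of $t$ with $\sup_{s\in V_t}|f_t-f_s|/|t-s|^{a}<\infty$ (in particular $z$ extends to the diagonal $t=\tau$).
   Formalization: In the estimate, ‖y‖_{(α',γ'),1,2} is replaced by the full norm ‖y‖_{(α',γ')} = ‖y‖_{(α',γ'),1} + ‖y‖_{(α',γ'),1,2}; the stated bound fails for z = y = t, where ‖y‖_{(α',γ'),1,2} = 0 but the product is (t−u)(u−s) > 0. *)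

theory Defs
  imports "HOL-Analysis.Analysis"
begin

text \<open>
  A map \<open>z\<close> on the triangle is a curried function, \<open>z \<tau> t\<close> being \<open>z\<^sup>\<tau>\<^sub>t\<close>. Only the values with
  \<open>0 \<le> t \<le> \<tau> \<le> T\<close> matter; \<open>z t t\<close> is the value of the extension to the diagonal.
\<close>

definition time_simplex :: "nat \<Rightarrow> real \<Rightarrow> real list set" where
  "time_simplex n T = {xs. length xs = n \<and> sorted_wrt (<) xs \<and> set xs \<subseteq> {0..T}}"


subsection \<open>Tensor products\<close>

text \<open>
  The target type is a completion of the algebraic tensor product of \<open>'a\<close> with itself under a norm
  with \<open>|a \<otimes> b| \<le> |a| |b|\<close>. The third conjunct states that the linear map induced by \<open>tens\<close> on the
  algebraic tensor product is injective, the fourth that its range is dense.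
\<close>

definition banach_tensor_product :: "('a::banach \<Rightarrow> 'a \<Rightarrow> 'b::banach) \<Rightarrow> bool" where
  "banach_tensor_product tens \<longleftrightarrow>
     bilinear tens \<and>
     (\<forall>a b. norm (tens a b) \<le> norm a * norm b) \<and>
     (\<forall>A b. finite A \<and> independent A \<and> (\<Sum>a\<in>A. tens a (b a)) = 0 \<longrightarrow> (\<forall>a\<in>A. b a = 0)) \<and>
     closure (span {tens a b | a b. True}) = UNIV"


subsection \<open>Volterra paths\<close>

definition volterra_quotients1 ::
    "real \<Rightarrow> real \<Rightarrow> real \<Rightarrow> (real \<Rightarrow> real \<Rightarrow> 'a::real_normed_vector) \<Rightarrow> real set" where
  "volterra_quotients1 T \<alpha> \<gamma> z =
     {norm (z \<tau> t - z \<tau> s) /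
        min ((\<tau> - t) powr (-\<gamma>) * (t - s) powr \<alpha>) ((\<tau> - s) powr (\<alpha> - \<gamma>))
      | s t \<tau>. [s, t, \<tau>] \<in> time_simplex 3 T}"

definition volterra_quotients12 ::
    "real \<Rightarrow> real \<Rightarrow> real \<Rightarrow> (real \<Rightarrow> real \<Rightarrow> 'a::real_normed_vector) \<Rightarrow> real set" where
  "volterra_quotients12 T \<alpha> \<gamma> z =
     {norm ((z \<tau> t - z \<tau>' t) - (z \<tau> s - z \<tau>' s)) /
        ((\<tau> - \<tau>') powr \<eta> * (\<tau>' - t) powr (-\<eta> + \<zeta>) *
         min ((\<tau>' - t) powr (-\<gamma> - \<zeta>) * (t - s) powr \<alpha>) ((\<tau>' - s) powr (\<alpha> - \<gamma> - \<zeta>)))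
      | s t \<tau>' \<tau> \<eta> \<zeta>. [s, t, \<tau>', \<tau>] \<in> time_simplex 4 T \<and> \<eta> \<in> {0..1} \<and> \<zeta> \<in> {0..<\<alpha> - \<gamma>}}"

text \<open>
  The three quantities below are meaningful only where the sets of quotients are bounded above,
  which is how \<open>volterra_paths\<close> expresses that the norm is finite. The second one vanishes whenever
  \<open>z \<tau> t\<close> does not depend on \<open>\<tau>\<close>, so it cannot alone control the right factor of a convolution: for
  \<open>z \<tau> t = y \<tau> t = t\<close> the convolution is \<open>(t - u) * (u - s)\<close>. The sum of the two does.
\<close>

definition volterra_norm1 ::
    "real \<Rightarrow> real \<Rightarrow> real \<Rightarrow> (real \<Rightarrow> real \<Rightarrow> 'a::real_normed_vector) \<Rightarrow> real" where
  "volterra_norm1 T \<alpha> \<gamma> z = Sup (volterra_quotients1 T \<alpha> \<gamma> z)"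

definition volterra_norm12 ::
    "real \<Rightarrow> real \<Rightarrow> real \<Rightarrow> (real \<Rightarrow> real \<Rightarrow> 'a::real_normed_vector) \<Rightarrow> real" where
  "volterra_norm12 T \<alpha> \<gamma> z = Sup (volterra_quotients12 T \<alpha> \<gamma> z)"

definition volterra_norm ::
    "real \<Rightarrow> real \<Rightarrow> real \<Rightarrow> (real \<Rightarrow> real \<Rightarrow> 'a::real_normed_vector) \<Rightarrow> real" where
  "volterra_norm T \<alpha> \<gamma> z = volterra_norm1 T \<alpha> \<gamma> z + volterra_norm12 T \<alpha> \<gamma> z"

text \<open>\<open>f \<in> C\<^sup>a({t})\<close> for a function \<open>f\<close> with domain \<open>S\<close>; neighbourhoods of \<open>t\<close> are relative to \<open>S\<close>.\<close>

definition holder_at :: "real \<Rightarrow> real set \<Rightarrow> real \<Rightarrow> (real \<Rightarrow> 'a::real_normed_vector) \<Rightarrow> bool" where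
  "holder_at a S t f \<longleftrightarrow>
     (\<exists>V. openin (top_of_set S) V \<and> t \<in> V \<and>
        bdd_above ((\<lambda>s. norm (f t - f s) / \<bar>t - s\<bar> powr a) ` (V - {t})))"

text \<open>
  \<open>f \<in> C\<^sup>a(S)\<close> for a half-open interval \<open>S\<close> is read locally, i.e. on compact subsets: a Volterra path
  such as \<open>\<integral>\<^sub>0\<^sup>t (\<tau> - r)\<^sup>-\<^sup>\<gamma> dr\<close> is in general only \<open>(\<alpha>-\<gamma>)\<close>-Hoelder up to the diagonal. For \<open>a = 1\<close> this is
  local Lipschitz continuity, which every continuously differentiable function satisfies.
\<close>

definition holder_on :: "real \<Rightarrow> real set \<Rightarrow> (real \<Rightarrow> 'a::real_normed_vector) \<Rightarrow> bool" where
  "holder_on a S f \<longleftrightarrow>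
     (\<forall>K. compact K \<and> K \<subseteq> S \<longrightarrow>
        bdd_above {norm (f t - f s) / \<bar>t - s\<bar> powr a | s t. s \<in> K \<and> t \<in> K \<and> s \<noteq> t})"

definition volterra_paths ::
    "real \<Rightarrow> real \<Rightarrow> real \<Rightarrow> (real \<Rightarrow> real \<Rightarrow> 'a::real_normed_vector) set" where
  "volterra_paths T \<alpha> \<gamma> = {z.
     (\<forall>\<tau>\<in>{0<..T}. holder_at (\<alpha> - \<gamma>) {0..\<tau>} \<tau> (\<lambda>t. z \<tau> t) \<and> holder_on \<alpha> {0..<\<tau>} (\<lambda>t. z \<tau> t)) \<and>
     (\<forall>t\<in>{0..<T}. holder_at (\<alpha> - \<gamma>) {t..T} t (\<lambda>\<tau>. z \<tau> t) \<and> holder_on 1 {t<..T} (\<lambda>\<tau>. z \<tau> t)) \<and>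
     (\<exists>z0. \<forall>\<tau>\<in>{0<..T}. z \<tau> 0 = z0) \<and>
     bdd_above (volterra_quotients1 T \<alpha> \<gamma> z) \<and>
     bdd_above (volterra_quotients12 T \<alpha> \<gamma> z)}"


subsection \<open>The convolution product\<close>

definition mesh_filter :: "real \<Rightarrow> real \<Rightarrow> real set set filter" where
  "mesh_filter u t =
     (INF \<delta>\<in>{0<..}. principal {P. P division_of {u..t} \<and> (\<forall>K\<in>P. Sup K - Inf K < \<delta>)})"

text \<open>A member \<open>K = [u', v']\<close> of a partition has \<open>u' = Inf K\<close> and \<open>v' = Sup K\<close>.\<close>

definition convolution_sum ::
    "('a::real_normed_vector \<Rightarrow> 'a \<Rightarrow> 'b::real_normed_vector) \<Rightarrow> (real \<Rightarrow> real \<Rightarrow> 'a) \<Rightarrow> (real \<Rightarrow> real \<Rightarrow> 'a) \<Rightarrow>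
     real \<Rightarrow> real \<Rightarrow> real \<Rightarrow> real set set \<Rightarrow> 'b" where
  "convolution_sum tens z y s u \<tau> P =
     (\<Sum>K\<in>P. tens (z \<tau> (Sup K) - z \<tau> (Inf K)) (y (Inf K) u - y (Inf K) s))"

definition convolution ::
    "('a::real_normed_vector \<Rightarrow> 'a \<Rightarrow> 'b::real_normed_vector) \<Rightarrow> (real \<Rightarrow> real \<Rightarrow> 'a) \<Rightarrow> (real \<Rightarrow> real \<Rightarrow> 'a) \<Rightarrow>
     real \<Rightarrow> real \<Rightarrow> real \<Rightarrow> real \<Rightarrow> 'b" where
  "convolution tens z y s u t \<tau> = Lim (mesh_filter u t) (convolution_sum tens z y s u \<tau>)"

end

theory Submission
  imports Defs
begin

text \<open>
  No Young integration is needed: the right factor \<open>g r = y r u - y r s\<close> has bounded variation on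
  \<open>[u, t]\<close>. Its increments are dominated by those of a constant multiple of
  \<open>(t - s)\<^sup>\<zeta> (r - u)\<^sup>\<zeta>\<close> with \<open>\<zeta> = (\<alpha>' - \<gamma>') / 2\<close>, which follows from the second Volterra norm. Summation
  by parts turns the convolution sums into a boundary term minus right-point Riemann--Stieltjes sums
  of the continuous function \<open>F r = z \<tau> r - z \<tau> u\<close> against \<open>g\<close>. Both are bounded by means of
  \<open>|F r| \<le> 2 |z| (\<tau> - u)\<^sup>-\<^sup>\<gamma> (t - u)\<^sup>\<alpha>\<close>, which combines the two bounds in the first Volterra norm
  and implies both parts of the final estimate.
\<close>

section \<open>Stieltjes sums\<close>

lemma real_division_ofE:
  fixes P :: "real set set"
  assumes "P division_of {u..t}" "K \<in> P"
  obtains a b where "K = {a..b}" "u \<le> a" "a \<le> b" "b \<le> t"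
proof -
  obtain a b where K: "K = {a..b}" "K \<noteq> {}" "K \<subseteq> {u..t}"
    using assms division_ofD(2,3,4) by (metis box_real(2))
  then show ?thesis using that[of a b] by auto
qed

text \<open>The left-endpoint tags are arbitrary; they serve to invoke additivity over tagged
  divisions. A division may contain degenerate intervals, which contribute zero.\<close>

lemma division_telescope:
  fixes h :: "real \<Rightarrow> 'a::real_normed_vector"
  assumes P: "P division_of {u..t}" and "u \<le> t"
  shows "(\<Sum>K\<in>P. h (Sup K) - h (Inf K)) = h t - h u"
proof -
  have "(\<lambda>K. (Inf K, K)) ` P tagged_division_of {u..t}"
    unfolding tagged_division_of
  proof (intro conjI allI impI)
    show "finite ((\<lambda>K. (Inf K, K)) ` P)" using P by auto
    show "\<Union>{K. \<exists>x. (x, K) \<in> (\<lambda>K. (Inf K, K)) ` P} = {u..t}"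
      using division_ofD(6)[OF P] by (auto simp: image_iff)
  next
    fix x K assume "(x, K) \<in> (\<lambda>K. (Inf K, K)) ` P"
    then have K: "K \<in> P" and x: "x = Inf K" by auto
    from real_division_ofE[OF P K] obtain a b where "K = {a..b}" "u \<le> a" "a \<le> b" "b \<le> t" .
    then show "x \<in> K" "K \<subseteq> {u..t}" "\<exists>a b. K = cbox a b" using x by auto
  next
    fix x K y L
    assume "(x, K) \<in> (\<lambda>K. (Inf K, K)) ` P \<and> (y, L) \<in> (\<lambda>K. (Inf K, K)) ` P \<and> (x, K) \<noteq> (y, L)"
    then show "interior K \<inter> interior L = {}" using division_ofD(5)[OF P] by auto
  qed
  from additive_tagged_division_1[OF \<open>u \<le> t\<close> this, of h]
  show ?thesis by (subst (asm) sum.reindex) (auto simp: inj_on_def)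
qed

text \<open>
  The increment of \<open>h\<close> over \<open>K \<inter> L\<close>. Clamping to \<open>K\<close> makes it additive in \<open>L\<close> without passing to
  a common refinement, and gives \<open>0\<close> for disjoint intervals.
\<close>

definition overlap_increment ::
    "(real \<Rightarrow> 'a::real_normed_vector) \<Rightarrow> real set \<Rightarrow> real set \<Rightarrow> 'a" where
  "overlap_increment h K L =
     h (max (Inf K) (min (Sup L) (Sup K))) - h (max (Inf K) (min (Inf L) (Sup K)))"

text \<open>The clamped function \<open>h (max (Inf K) (min x (Sup K)))\<close> of \<open>x\<close>
  telescopes over \<open>Q\<close>. Since \<open>K\<close> lies in \<open>{u..t}\<close>, clamping
  sends \<open>t\<close> to \<open>Sup K\<close> and \<open>u\<close> to
  \<open>Inf K\<close>.\<close>

lemma sum_overlap_increment: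
  assumes Q: "Q division_of {u..t}" and "u \<le> t" and P: "P division_of {u..t}" and "K \<in> P"
  shows "(\<Sum>L\<in>Q. overlap_increment h K L) = h (Sup K) - h (Inf K)"
proof -
  from real_division_ofE[OF P \<open>K \<in> P\<close>] obtain a b
    where K: "K = {a..b}" "u \<le> a" "a \<le> b" "b \<le> t" .
  show ?thesis
    using division_telescope[OF Q \<open>u \<le> t\<close>, of "\<lambda>x. h (max (Inf K) (min x (Sup K)))"] K
    by (simp add: overlap_increment_def max_def min_def split: if_splits)
qed

text \<open>If the intervals meet, both sides are the increment of \<open>h\<close> from
  \<open>max a c\<close> to \<open>min b d\<close>; otherwise both vanish. Hence either of two
  divisions may do the clamping.\<close>

lemma overlap_increment_commute:
  assumes "a \<le> b" "c \<le> d"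
  shows "overlap_increment h {a..b} {c..d} = overlap_increment h {c..d} {a..b}"
  using assms by (auto simp: overlap_increment_def max_def min_def)

lemma overlap_increment_disjoint:
  assumes "a \<le> b" "c \<le> d" "b < c \<or> d < a"
  shows "overlap_increment h {a..b} {c..d} = 0"
  using assms by (auto simp: overlap_increment_def max_def min_def)

lemma norm_overlap_increment_le:
  fixes g :: "real \<Rightarrow> 'a::real_normed_vector"
  assumes "a \<le> b" "c \<le> d" "{a..b} \<subseteq> {u..t}"
    and "\<And>r v. u \<le> r \<Longrightarrow> r \<le> v \<Longrightarrow> v \<le> t \<Longrightarrow> norm (g v - g r) \<le> G v - G r"
  shows "norm (overlap_increment g {a..b} {c..d}) \<le> overlap_increment G {a..b} {c..d}"
  unfolding overlap_increment_def using assms(1-3) by (intro assms(4)) auto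

definition stieltjes_sum ::
    "('a::real_normed_vector \<Rightarrow> 'a \<Rightarrow> 'b::real_normed_vector) \<Rightarrow> (real \<Rightarrow> 'a) \<Rightarrow> (real \<Rightarrow> 'a) \<Rightarrow> real set set \<Rightarrow> 'b"
  where "stieltjes_sum tens F g P = (\<Sum>K\<in>P. tens (F (Sup K)) (g (Sup K) - g (Inf K)))"

locale contractive_bilinear = bounded_bilinear tens
  for tens :: "'a::real_normed_vector \<Rightarrow> 'a \<Rightarrow> 'b::real_normed_vector" +
  assumes norm_tens_le: "norm (tens a b) \<le> norm a * norm b"
begin

text \<open>The scalar \<open>G\<close> controls the variation of \<open>g\<close>, so the bounds on
  the single terms telescope to a quantity that does not depend on the division.\<close>

lemma norm_stieltjes_sum_le:
  fixes F g :: "real \<Rightarrow> 'a"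
  assumes P: "P division_of {u..t}" and "u \<le> t"
    and F: "\<And>r. r \<in> {u..t} \<Longrightarrow> norm (F r) \<le> X"
    and g: "\<And>r v. u \<le> r \<Longrightarrow> r \<le> v \<Longrightarrow> v \<le> t \<Longrightarrow> norm (g v - g r) \<le> G v - G r"
  shows "norm (stieltjes_sum tens F g P) \<le> X * (G t - G u)"
proof -
  have "norm (stieltjes_sum tens F g P) \<le> (\<Sum>K\<in>P. X * (G (Sup K) - G (Inf K)))"
    unfolding stieltjes_sum_def
  proof (rule sum_norm_le)
    fix K assume "K \<in> P"
    from real_division_ofE[OF P this] obtain a b where K: "K = {a..b}" "u \<le> a" "a \<le> b" "b \<le> t" .
    have "norm (tens (F b) (g b - g a)) \<le> norm (F b) * norm (g b - g a)" by (rule norm_tens_le)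
    also have "\<dots> \<le> X * (G b - G a)"
      using K F[of b] g[of a b] by (intro mult_mono) (auto intro: order_trans[OF norm_ge_zero])
    finally show "norm (tens (F (Sup K)) (g (Sup K) - g (Inf K))) \<le> X * (G (Sup K) - G (Inf K))"
      using K by simp
  qed
  also have "\<dots> = X * (G t - G u)"
    using division_telescope[OF P \<open>u \<le> t\<close>, of G] by (simp add: sum_distrib_left[symmetric])
  finally show ?thesis .
qed

text \<open>Both sums are expanded over all pairs of intervals with the same weights
  \<open>overlap_increment g K L\<close>, so that only the values of \<open>F\<close> differ. Pairs
  that do not meet have weight zero; for the others the two evaluation points are close.\<close>

lemma stieltjes_sum_diff_le:
  fixes F g :: "real \<Rightarrow> 'a"
  assumes P: "P division_of {u..t}" and Q: "Q division_of {u..t}" and "u \<le> t"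
    and mP: "\<And>K. K \<in> P \<Longrightarrow> Sup K - Inf K < \<delta>" and mQ: "\<And>K. K \<in> Q \<Longrightarrow> Sup K - Inf K < \<delta>"
    and F: "\<And>x x'. x \<in> {u..t} \<Longrightarrow> x' \<in> {u..t} \<Longrightarrow> \<bar>x - x'\<bar> < \<delta> \<Longrightarrow> norm (F x - F x') \<le> e"
    and g: "\<And>r v. u \<le> r \<Longrightarrow> r \<le> v \<Longrightarrow> v \<le> t \<Longrightarrow> norm (g v - g r) \<le> G v - G r"
  shows "norm (stieltjes_sum tens F g P - stieltjes_sum tens F g Q) \<le> e * (G t - G u)"
proof -
  have "stieltjes_sum tens F g P = (\<Sum>K\<in>P. \<Sum>L\<in>Q. tens (F (Sup K)) (overlap_increment g K L))"
    unfolding stieltjes_sum_def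
    using sum_overlap_increment[OF Q \<open>u \<le> t\<close> P, of _ g] by (simp add: sum_right[symmetric])
  moreover have "stieltjes_sum tens F g Q = (\<Sum>K\<in>P. \<Sum>L\<in>Q. tens (F (Sup L)) (overlap_increment g K L))"
  proof -
    have "stieltjes_sum tens F g Q = (\<Sum>L\<in>Q. \<Sum>K\<in>P. tens (F (Sup L)) (overlap_increment g L K))"
      unfolding stieltjes_sum_def
      using sum_overlap_increment[OF P \<open>u \<le> t\<close> Q, of _ g] by (simp add: sum_right[symmetric])
    also have "\<dots> = (\<Sum>L\<in>Q. \<Sum>K\<in>P. tens (F (Sup L)) (overlap_increment g K L))"
      by (intro sum.cong refl arg_cong[where f="tens _"])
         (metis real_division_ofE[OF P] real_division_ofE[OF Q] overlap_increment_commute)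
    finally show ?thesis by (simp add: sum.swap[of _ P])
  qed
  ultimately have "stieltjes_sum tens F g P - stieltjes_sum tens F g Q =
      (\<Sum>K\<in>P. \<Sum>L\<in>Q. tens (F (Sup K) - F (Sup L)) (overlap_increment g K L))"
    by (simp add: sum_subtractf diff_left)
  also have "norm \<dots> \<le> (\<Sum>K\<in>P. \<Sum>L\<in>Q. e * overlap_increment G K L)"
  proof (intro sum_norm_le)
    fix K L assume KL: "K \<in> P" "L \<in> Q"
    from real_division_ofE[OF P KL(1)] obtain a b where K: "K = {a..b}" "u \<le> a" "a \<le> b" "b \<le> t" .
    from real_division_ofE[OF Q KL(2)] obtain c d where L: "L = {c..d}" "u \<le> c" "c \<le> d" "d \<le> t" .
    show "norm (tens (F (Sup K) - F (Sup L)) (overlap_increment g K L)) \<le> e * overlap_increment G K L"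
    proof (cases "b < c \<or> d < a")
      case True
      then have "overlap_increment g K L = 0" "overlap_increment G K L = 0"
        unfolding K(1) L(1) using K L by (simp_all add: overlap_increment_disjoint)
      then show ?thesis by (simp add: zero_right)
    next
      case False
      have "norm (overlap_increment g K L) \<le> overlap_increment G K L"
        unfolding K(1) L(1) using K L by (intro norm_overlap_increment_le[where u=u and t=t] g) auto
      \<comment> \<open>As the intervals meet, \<open>a \<le> d\<close> and
        \<open>c \<le> b\<close>. So \<open>b - d \<le> b - a\<close> and
        \<open>d - b \<le> d - c\<close>, both below \<open>\<delta>\<close>.\<close>
      moreover have "norm (F b - F d) \<le> e"
        using mP[OF KL(1)] mQ[OF KL(2)] K L False by (intro F) auto
      ultimately have "norm (F b - F d) * norm (overlap_increment g K L) \<le> e * overlap_increment G K L"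
        by (intro mult_mono) (auto intro: order_trans[OF norm_ge_zero])
      then show ?thesis using norm_tens_le[of "F b - F d" "overlap_increment g K L"] K L by simp
    qed
  qed
  also have "\<dots> = e * (G t - G u)"
    using sum_overlap_increment[OF Q \<open>u \<le> t\<close> P, of _ G] division_telescope[OF P \<open>u \<le> t\<close>, of G]
    by (simp add: sum_distrib_left[symmetric])
  finally show ?thesis .
qed

end

section \<open>Limits along partitions of vanishing mesh\<close>

lemma eventually_mesh_filter:
  "eventually R (mesh_filter u t) \<longleftrightarrow>
     (\<exists>\<delta>>0. \<forall>P. P division_of {u..t} \<and> (\<forall>K\<in>P. Sup K - Inf K < \<delta>) \<longrightarrow> R P)"
proof -
  have "eventually R (mesh_filter u t) \<longleftrightarrow>
      (\<exists>\<delta>\<in>{0<..}. eventually R (principal {P. P division_of {u..t} \<and> (\<forall>K\<in>P. Sup K - Inf K < \<delta>)}))"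
    unfolding mesh_filter_def
    by (rule eventually_INF_base)
       (force intro!: bexI[of _ "min _ _"])+
  then show ?thesis by (auto simp: eventually_principal)
qed

text \<open>Cousin's lemma for the constant gauge of radius \<open>\<delta> / 2\<close> gives a
  division of mesh below \<open>\<delta>\<close>. Nontriviality of the filter makes limits unique,
  hence \<open>convolution\<close> meaningful.\<close>

lemma mesh_filter_neq_bot: "mesh_filter u t \<noteq> bot"
proof
  assume "mesh_filter u t = bot"
  then have "eventually (\<lambda>_. False) (mesh_filter u t)" by simp
  then obtain \<delta> where "\<delta> > 0"
    and no: "\<And>P. P division_of {u..t} \<Longrightarrow> \<exists>K\<in>P. \<not> Sup K - Inf K < \<delta>"
    unfolding eventually_mesh_filter by blast
  have "gauge (\<lambda>x. ball x (\<delta> / 2))" using \<open>\<delta> > 0\<close> by (simp add: gauge_ball)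
  then obtain p where p: "p tagged_division_of {u..t}" "(\<lambda>x. ball x (\<delta> / 2)) fine p"
    using fine_division_exists_real by blast
  from no[OF division_of_tagged_division[OF p(1)]]
  obtain x K where xK: "(x, K) \<in> p" "\<not> Sup K - Inf K < \<delta>" by auto
  obtain a b where K: "K = {a..b}" using tagged_division_ofD(4)[OF p(1) xK(1)] by auto
  have "x \<in> K" using tagged_division_ofD(2)[OF p(1) xK(1)] .
  then have "a \<in> K" "b \<in> K" using K by auto
  then have "a \<in> ball x (\<delta> / 2)" "b \<in> ball x (\<delta> / 2)" using fineD[OF p(2) xK(1)] by blast+
  then show False using xK(2) K \<open>x \<in> K\<close> by (auto simp: dist_real_def)
qed

text \<open>The integrand is uniformly continuous on the compact interval and the integrator has
  variation at most \<open>G t - G u\<close>, so any two sufficiently fine sums are close; they need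
  not refine one another.\<close>

lemma (in contractive_bilinear) stieltjes_sum_Cauchy:
  fixes F g :: "real \<Rightarrow> 'a"
  assumes "u \<le> t" and F: "continuous_on {u..t} F"
    and g: "\<And>r v. u \<le> r \<Longrightarrow> r \<le> v \<Longrightarrow> v \<le> t \<Longrightarrow> norm (g v - g r) \<le> G v - G r"
  shows "cauchy_filter (filtermap (stieltjes_sum tens F g) (mesh_filter u t))"
  unfolding cauchy_filter_metric_filtermap
proof (intro allI impI)
  fix e :: real assume "e > 0"
  have G: "G t - G u \<ge> 0" using g[of u t] \<open>u \<le> t\<close> norm_ge_zero order_trans by blast
  \<comment> \<open>The added 1 avoids division by zero when \<open>G t = G u\<close> and makes the
    final inequality strict.\<close>
  define e' where "e' = e / (G t - G u + 1)"
  have "e' > 0" using \<open>e > 0\<close> G by (simp add: e'_def)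
  have "uniformly_continuous_on {u..t} F"
    using F by (simp add: compact_uniformly_continuous)
  from uniformly_continuous_onE[OF this \<open>e' > 0\<close>] obtain \<delta> where \<delta>: "\<delta> > 0"
    and un: "\<And>x x'. x \<in> {u..t} \<Longrightarrow> x' \<in> {u..t} \<Longrightarrow> dist x' x < \<delta> \<Longrightarrow> dist (F x') (F x) < e'"
    by metis
  let ?R = "\<lambda>P. P division_of {u..t} \<and> (\<forall>K\<in>P. Sup K - Inf K < \<delta>)"
  have "dist (stieltjes_sum tens F g P) (stieltjes_sum tens F g Q) < e" if "?R P" "?R Q" for P Q
  proof -
    have "norm (stieltjes_sum tens F g P - stieltjes_sum tens F g Q) \<le> e' * (G t - G u)"
      using that by (intro stieltjes_sum_diff_le[where \<delta>=\<delta>] \<open>u \<le> t\<close> g)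
        (auto simp: dist_norm[symmetric] dist_real_def intro!: less_imp_le un)
    also have "\<dots> < e' * (G t - G u + 1)" using \<open>e' > 0\<close> by simp
    also have "\<dots> = e" using G by (simp add: e'_def)
    finally show ?thesis by (simp add: dist_norm)
  qed
  moreover have "eventually ?R (mesh_filter u t)"
    using \<delta> unfolding eventually_mesh_filter by blast
  ultimately show "\<exists>R. eventually R (mesh_filter u t) \<and>
      (\<forall>P Q. R P \<and> R Q \<longrightarrow> dist (stieltjes_sum tens F g P) (stieltjes_sum tens F g Q) < e)"
    by (intro exI[of _ ?R]) blast
qed

text \<open>The mesh limit is not a sequential one, so completeness is used in its form for Cauchy
  filters.\<close>

lemma cauchy_filter_imp_tendsto:
  fixes f :: "'c \<Rightarrow> 'b::banach"
  assumes "cauchy_filter (filtermap f F)" "F \<noteq> bot"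
  shows "\<exists>L. (f \<longlongrightarrow> L) F"
proof -
  have "complete (UNIV :: 'b set)"
    by (meson Cauchy_convergent UNIV_I complete_def convergent_def)
  then show ?thesis
    using assms complete_uniform[where S="UNIV :: 'b set"] by (force simp: filterlim_def filtermap_bot_iff)
qed


section \<open>Volterra paths\<close>

lemma holder_on_imp_continuous_on:
  assumes "holder_on a S f" "a > 0" "compact K" "K \<subseteq> S"
  shows "continuous_on K f"
proof -
  have "bdd_above {norm (f t - f s) / \<bar>t - s\<bar> powr a | s t. s \<in> K \<and> t \<in> K \<and> s \<noteq> t}"
    using assms by (simp add: holder_on_def)
  then obtain M where "\<forall>q\<in>{norm (f t - f s) / \<bar>t - s\<bar> powr a | s t. s \<in> K \<and> t \<in> K \<and> s \<noteq> t}. q \<le> M"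
    unfolding bdd_above_def by auto
  then have M: "norm (f t - f s) / \<bar>t - s\<bar> powr a \<le> M" if "s \<in> K" "t \<in> K" "s \<noteq> t" for s t
    using that by blast
  have le: "norm (f s - f t) \<le> M * \<bar>s - t\<bar> powr a" if "s \<in> K" "t \<in> K" for s t
    using M[of t s] that by (cases "s = t") (auto simp: field_simps)
  show ?thesis
    unfolding continuous_on_def
  proof
    fix t assume "t \<in> K"
    have "((\<lambda>s. M * \<bar>s - t\<bar> powr a) \<longlongrightarrow> M * \<bar>t - t\<bar> powr a) (at t within K)"
      using \<open>a > 0\<close> by (intro tendsto_intros) auto
    then have "((\<lambda>s. M * \<bar>s - t\<bar> powr a) \<longlongrightarrow> 0) (at t within K)" by simp
    moreover have "\<forall>\<^sub>F s in at t within K. norm (f s - f t) \<le> M * \<bar>s - t\<bar> powr a"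
      unfolding eventually_at using le \<open>t \<in> K\<close> by (intro exI[of _ 1]) simp
    ultimately have "((\<lambda>s. f s - f t) \<longlongrightarrow> 0) (at t within K)"
      by (rule Lim_null_comparison[rotated])
    then show "(f \<longlongrightarrow> f t) (at t within K)" by (simp add: LIM_zero_iff)
  qed
qed

text \<open>On the diagonal only the pointwise condition is available. It is applied to the upper
  variable of the right factor as that variable decreases to the lower one.\<close>

lemma holder_at_imp_tendsto:
  assumes "holder_at a S t f" "a > 0"
  shows "(f \<longlongrightarrow> f t) (at t within S)"
proof -
  obtain V M where V: "openin (top_of_set S) V" "t \<in> V"
    and M: "\<And>s. s \<in> V - {t} \<Longrightarrow> norm (f t - f s) / \<bar>t - s\<bar> powr a \<le> M"
    using assms unfolding holder_at_def bdd_above_def by blast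
  obtain e where e: "e > 0" "ball t e \<inter> S \<subseteq> V" using V unfolding openin_contains_ball by blast
  have le: "norm (f s - f t) \<le> M * \<bar>s - t\<bar> powr a" if "s \<in> V" "s \<noteq> t" for s
    using M[of s] that by (auto simp: field_simps norm_minus_commute abs_minus_commute)
  have "((\<lambda>s. M * \<bar>s - t\<bar> powr a) \<longlongrightarrow> M * \<bar>t - t\<bar> powr a) (at t within S)"
    using \<open>a > 0\<close> by (intro tendsto_intros) auto
  then have "((\<lambda>s. M * \<bar>s - t\<bar> powr a) \<longlongrightarrow> 0) (at t within S)" by simp
  moreover have "\<forall>\<^sub>F s in at t within S. norm (f s - f t) \<le> M * \<bar>s - t\<bar> powr a"
    unfolding eventually_at
  proof (intro exI[of _ e] conjI ballI impI)
    fix s assume "s \<in> S" "s \<noteq> t \<and> dist s t < e"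
    then have "s \<in> ball t e \<inter> S" by (simp add: dist_commute)
    then show "norm (f s - f t) \<le> M * \<bar>s - t\<bar> powr a"
      using e le \<open>s \<noteq> t \<and> dist s t < e\<close> by blast
  qed (rule e)
  ultimately have "((\<lambda>s. f s - f t) \<longlongrightarrow> 0) (at t within S)"
    by (rule Lim_null_comparison[rotated])
  then show ?thesis by (simp add: LIM_zero_iff)
qed

section \<open>Estimates read off from the two Volterra norms\<close>

lemma time_simplex_3: "[s, t, \<tau>] \<in> time_simplex 3 T \<longleftrightarrow> 0 \<le> s \<and> s < t \<and> t < \<tau> \<and> \<tau> \<le> T"
  by (auto simp: time_simplex_def)

lemma time_simplex_4:
  "[s, t, \<tau>', \<tau>] \<in> time_simplex 4 T \<longleftrightarrow> 0 \<le> s \<and> s < t \<and> t < \<tau>' \<and> \<tau>' < \<tau> \<and> \<tau> \<le> T"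
  by (auto simp: time_simplex_def)

lemma volterra_norm1_bound:
  assumes "z \<in> volterra_paths T \<alpha> \<gamma>" "0 \<le> s" "s < t" "t < \<tau>" "\<tau> \<le> T"
  shows "norm (z \<tau> t - z \<tau> s) \<le> volterra_norm1 T \<alpha> \<gamma> z *
      min ((\<tau> - t) powr (-\<gamma>) * (t - s) powr \<alpha>) ((\<tau> - s) powr (\<alpha> - \<gamma>))" (is "?n \<le> _ * ?d")
proof -
  have "?n / ?d \<in> volterra_quotients1 T \<alpha> \<gamma> z"
    using assms by (auto simp: volterra_quotients1_def time_simplex_3)
  then have "?n / ?d \<le> volterra_norm1 T \<alpha> \<gamma> z"
    using assms(1) unfolding volterra_norm1_def by (intro cSup_upper) (simp_all add: volterra_paths_def)
  moreover have "?d > 0" using assms by auto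
  ultimately show ?thesis by (simp add: pos_divide_le_eq del: min_less_iff_conj)
qed

lemma volterra_norm12_bound:
  assumes "z \<in> volterra_paths T \<alpha> \<gamma>" "0 \<le> s" "s < t" "t < \<tau>'" "\<tau>' < \<tau>" "\<tau> \<le> T"
    and "0 \<le> \<eta>" "\<eta> \<le> 1" "0 \<le> \<zeta>" "\<zeta> < \<alpha> - \<gamma>"
  shows "norm ((z \<tau> t - z \<tau>' t) - (z \<tau> s - z \<tau>' s)) \<le> volterra_norm12 T \<alpha> \<gamma> z *
      ((\<tau> - \<tau>') powr \<eta> * (\<tau>' - t) powr (-\<eta> + \<zeta>) *
       min ((\<tau>' - t) powr (-\<gamma> - \<zeta>) * (t - s) powr \<alpha>) ((\<tau>' - s) powr (\<alpha> - \<gamma> - \<zeta>)))" (is "?n \<le> _ * ?d")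
proof -
  have "?n / ?d \<in> volterra_quotients12 T \<alpha> \<gamma> z"
    unfolding volterra_quotients12_def mem_Collect_eq
    by (rule exI[of _ s], rule exI[of _ t], rule exI[of _ \<tau>'], rule exI[of _ \<tau>], rule exI[of _ \<eta>],
        rule exI[of _ \<zeta>], intro conjI refl) (use assms in \<open>simp_all add: time_simplex_4\<close>)
  then have "?n / ?d \<le> volterra_norm12 T \<alpha> \<gamma> z"
    using assms(1) unfolding volterra_norm12_def by (intro cSup_upper) (simp_all add: volterra_paths_def)
  moreover have "?d > 0" using assms by auto
  ultimately show ?thesis by (simp add: pos_divide_le_eq)
qed

text \<open>One sample suffices: the times 0, T/2, T give a nonnegative numerator over a positive
  denominator.\<close>

lemma volterra_norm1_nonneg:
  assumes "z \<in> volterra_paths T \<alpha> \<gamma>" "T > 0"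
  shows "volterra_norm1 T \<alpha> \<gamma> z \<ge> 0"
proof -
  have "0 \<le> volterra_norm1 T \<alpha> \<gamma> z *
      min ((T - T/2) powr (-\<gamma>) * (T/2 - 0) powr \<alpha>) ((T - 0) powr (\<alpha> - \<gamma>))" (is "0 \<le> _ * ?d")
    using assms by (intro order_trans[OF norm_ge_zero volterra_norm1_bound]) auto
  moreover have "?d > 0" using assms by auto
  ultimately show ?thesis using zero_le_mult_iff not_less by blast
qed

lemma volterra_norm12_nonneg:
  assumes "z \<in> volterra_paths T \<alpha> \<gamma>" "T > 0" "\<alpha> - \<gamma> > 0"
  shows "volterra_norm12 T \<alpha> \<gamma> z \<ge> 0"
proof -
  \<comment> \<open>Sample times 0, T/3, T/2, T with both exponents zero; \<open>\<zeta> = 0\<close>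
    is admissible because \<open>\<alpha> - \<gamma> > 0\<close>.\<close>
  have "0 \<le> volterra_norm12 T \<alpha> \<gamma> z *
      ((T - T/2) powr 0 * (T/2 - T/3) powr (-0 + 0) *
       min ((T/2 - T/3) powr (-\<gamma> - 0) * (T/3 - 0) powr \<alpha>) ((T/2 - 0) powr (\<alpha> - \<gamma> - 0)))" (is "0 \<le> _ * ?d")
    using assms by (intro order_trans[OF norm_ge_zero volterra_norm12_bound]) auto
  moreover have "?d > 0" using assms by auto
  ultimately show ?thesis using zero_le_mult_iff not_less by blast
qed


section \<open>The two factors of a convolution\<close>

text \<open>
  Singular weights \<open>|v - r|\<^sup>\<eta> r\<^sup>\<zeta>\<^sup>-\<^sup>\<eta>\<close> are dominated by increments of \<open>r\<^sup>\<zeta>\<close>, provided that \<open>\<eta> = 1\<close> is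
  used for \<open>v \<le> 2 r\<close> and \<open>\<eta> = \<zeta>\<close> for \<open>v > 2 r\<close>.
\<close>

definition weight_const :: "real \<Rightarrow> real" where
  "weight_const \<zeta> = 2 powr (1 - \<zeta>) / \<zeta> + 1 / (1 - 2 powr (-\<zeta>))"

lemma weight_const_pos: "0 < \<zeta> \<Longrightarrow> 0 < weight_const \<zeta>"
  by (auto simp: weight_const_def powr_less_one intro!: add_pos_pos)

lemma singular_weight_le:
  fixes x w \<zeta> :: real
  assumes "0 < \<zeta>" "\<zeta> < 1" "0 < x" "x < w"
  shows "\<exists>\<eta>\<in>{\<zeta>, 1}. (w - x) powr \<eta> * x powr (-\<eta> + \<zeta>) \<le> weight_const \<zeta> * (w powr \<zeta> - x powr \<zeta>)"
proof -
  have inc: "w powr \<zeta> - x powr \<zeta> \<ge> 0" using assms by (simp add: powr_mono2)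
  have p1: "1 / (1 - 2 powr (-\<zeta>)) > 0" using assms by (simp add: powr_less_one)
  have p2: "2 powr (1 - \<zeta>) / \<zeta> > 0" using assms by simp
  show ?thesis
  proof (cases "w \<le> 2 * x")
    case True
    \<comment> \<open>Mean value theorem with an intermediate point below \<open>2 * x\<close>: the
      derivative there is comparable to that at \<open>x\<close>, which produces the first summand
      of \<open>weight_const\<close> with \<open>\<eta> = 1\<close>.\<close>
    have "\<exists>c. x < c \<and> c < w \<and> w powr \<zeta> - x powr \<zeta> = (w - x) * (\<zeta> * c powr (\<zeta> - 1))"
      using assms by (intro MVT2) (auto intro!: derivative_eq_intros simp: powr_diff)
    then obtain c where c: "x < c" "c < w"
      and eq: "w powr \<zeta> - x powr \<zeta> = (w - x) * (\<zeta> * c powr (\<zeta> - 1))" by blast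
    have "2 powr (\<zeta> - 1) * x powr (\<zeta> - 1) = (2 * x) powr (\<zeta> - 1)"
      using assms by (simp add: powr_mult)
    also have "\<dots> \<le> c powr (\<zeta> - 1)" using assms c True by (intro powr_mono2') auto
    finally have "2 powr (1 - \<zeta>) * (2 powr (\<zeta> - 1) * x powr (\<zeta> - 1)) \<le> 2 powr (1 - \<zeta>) * c powr (\<zeta> - 1)"
      by (intro mult_left_mono) auto
    then have "x powr (\<zeta> - 1) \<le> 2 powr (1 - \<zeta>) * c powr (\<zeta> - 1)"
      by (simp add: mult.assoc[symmetric] powr_add[symmetric])
    then have "(w - x) * x powr (\<zeta> - 1) \<le> (w - x) * (2 powr (1 - \<zeta>) * c powr (\<zeta> - 1))"
      using assms by (intro mult_left_mono) auto
    also have "\<dots> = 2 powr (1 - \<zeta>) / \<zeta> * (w powr \<zeta> - x powr \<zeta>)" using assms by (simp add: eq)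
    also have "\<dots> \<le> weight_const \<zeta> * (w powr \<zeta> - x powr \<zeta>)"
      using inc p1 by (intro mult_right_mono) (auto simp: weight_const_def)
    finally show ?thesis using assms by (intro bexI[of _ 1]) (auto simp: algebra_simps)
  next
    case False
    \<comment> \<open>Now the increment is a fixed fraction of \<open>w powr \<zeta>\<close>. With
      \<open>\<eta> = \<zeta>\<close> the singular factor is 1, and the second summand of
      \<open>weight_const\<close> suffices.\<close>
    have "x powr \<zeta> \<le> (w / 2) powr \<zeta>" using assms False by (intro powr_mono2) auto
    also have "\<dots> = w powr \<zeta> * 2 powr (-\<zeta>)" using assms by (simp add: powr_divide powr_minus divide_simps)
    finally have "w powr \<zeta> * (1 - 2 powr (-\<zeta>)) \<le> w powr \<zeta> - x powr \<zeta>" by (simp add: algebra_simps)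
    then have "w powr \<zeta> \<le> 1 / (1 - 2 powr (-\<zeta>)) * (w powr \<zeta> - x powr \<zeta>)"
      using p1 by (simp add: field_simps)
    also have "\<dots> \<le> weight_const \<zeta> * (w powr \<zeta> - x powr \<zeta>)"
      using inc p2 by (intro mult_right_mono) (auto simp: weight_const_def)
    finally have "w powr \<zeta> \<le> weight_const \<zeta> * (w powr \<zeta> - x powr \<zeta>)" .
    moreover have "(w - x) powr \<zeta> \<le> w powr \<zeta>" using assms by (intro powr_mono2) auto
    ultimately show ?thesis using assms by (intro bexI[of _ \<zeta>]) auto
  qed
qed

text \<open>A positive \<open>\<zeta>\<close> in the second norm tempers the singularity at
  \<open>r = u\<close>, and \<open>\<eta>\<close> may be chosen anew for each pair \<open>r\<close>,
  \<open>v\<close>. Taking \<open>\<zeta>\<close> to be half of \<open>\<alpha> - \<gamma>\<close>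
  leaves the same power \<open>\<zeta>\<close> for \<open>r - s\<close>.\<close>

lemma volterra_right_factor:
  fixes y :: "real \<Rightarrow> real \<Rightarrow> 'a::real_normed_vector"
  assumes y: "y \<in> volterra_paths T \<alpha> \<gamma>" and \<rho>: "0 < \<alpha> - \<gamma>" "\<alpha> - \<gamma> < 1"
    and st: "0 \<le> s" "s < u" "u < t" "t \<le> T" and rv: "u \<le> r" "r \<le> v" "v \<le> t"
  defines "\<zeta> \<equiv> (\<alpha> - \<gamma>) / 2"
  defines "M \<equiv> volterra_norm12 T \<alpha> \<gamma> y * weight_const \<zeta> * (t - s) powr \<zeta>"
  shows "norm ((y v u - y v s) - (y r u - y r s)) \<le> M * (v - u) powr \<zeta> - M * (r - u) powr \<zeta>"
proof -
  have \<zeta>: "0 < \<zeta>" "\<zeta> < 1" "\<zeta> < \<alpha> - \<gamma>" "\<alpha> - \<gamma> - \<zeta> = \<zeta>" using \<rho> by (auto simp: \<zeta>_def field_simps)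
  have B: "volterra_norm12 T \<alpha> \<gamma> y \<ge> 0" using volterra_norm12_nonneg[OF y] \<rho> st by auto
  have interior: "norm ((y v u - y v s) - (y r u - y r s)) \<le> M * (v - u) powr \<zeta> - M * (r - u) powr \<zeta>"
    if rv: "u < r" "r < v" "v \<le> t" for r v
  proof -
    have "\<exists>\<eta>\<in>{\<zeta>, 1}. ((v - u) - (r - u)) powr \<eta> * (r - u) powr (-\<eta> + \<zeta>)
        \<le> weight_const \<zeta> * ((v - u) powr \<zeta> - (r - u) powr \<zeta>)"
      using \<zeta> rv by (intro singular_weight_le) auto
    then obtain \<eta> where \<eta>: "\<eta> = \<zeta> \<or> \<eta> = 1"
      and w: "((v - u) - (r - u)) powr \<eta> * (r - u) powr (-\<eta> + \<zeta>)
        \<le> weight_const \<zeta> * ((v - u) powr \<zeta> - (r - u) powr \<zeta>)" by blast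
    \<comment> \<open>The rectangular increment is regrouped to difference the upper variable first,
      as in the second norm.\<close>
    have "(y v u - y v s) - (y r u - y r s) = (y v u - y r u) - (y v s - y r s)" by simp
    also have "norm \<dots> \<le> volterra_norm12 T \<alpha> \<gamma> y * ((v - r) powr \<eta> * (r - u) powr (-\<eta> + \<zeta>) *
       min ((r - u) powr (-\<gamma> - \<zeta>) * (u - s) powr \<alpha>) ((r - s) powr (\<alpha> - \<gamma> - \<zeta>)))"
      using \<zeta> \<eta> st rv by (intro volterra_norm12_bound[OF y]) auto
    also have "\<dots> \<le> volterra_norm12 T \<alpha> \<gamma> y *
        (weight_const \<zeta> * ((v - u) powr \<zeta> - (r - u) powr \<zeta>) * (t - s) powr \<zeta>)"
    proof (rule mult_left_mono[OF _ B], rule mult_mono)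
      have "(r - s) powr \<zeta> \<le> (t - s) powr \<zeta>" using \<zeta> st rv by (intro powr_mono2) auto
      then show "min ((r - u) powr (-\<gamma> - \<zeta>) * (u - s) powr \<alpha>) ((r - s) powr (\<alpha> - \<gamma> - \<zeta>)) \<le> (t - s) powr \<zeta>"
        using \<zeta> by auto
      show "(v - r) powr \<eta> * (r - u) powr (- \<eta> + \<zeta>) \<le> weight_const \<zeta> * ((v - u) powr \<zeta> - (r - u) powr \<zeta>)"
        using w by simp
      show "0 \<le> weight_const \<zeta> * ((v - u) powr \<zeta> - (r - u) powr \<zeta>)"
        using weight_const_pos[of \<zeta>] \<zeta> rv by (auto intro!: mult_nonneg_nonneg powr_mono2)
    qed auto
    also have "\<dots> = M * (v - u) powr \<zeta> - M * (r - u) powr \<zeta>" by (simp add: M_def algebra_simps)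
    finally show ?thesis .
  qed
  consider "r = v" | "u < r" "r < v" | "r = u" "u < v" using rv by linarith
  then show ?thesis
  proof cases
    case 1 then show ?thesis by simp
  next
    case 2 then show ?thesis using interior rv by blast
  next
    case 3
    \<comment> \<open>The second norm does not see the diagonal, so the bound at
      \<open>r = u\<close> is the limit of the interior one as \<open>r\<close> decreases to
      \<open>u\<close>. The term at \<open>u\<close> converges by the condition on the diagonal, the
      one at \<open>s < u\<close> by the local Lipschitz condition.\<close>
    have sub: "at_right u \<le> at u within {u..T}"
      using st by (subst at_within_Icc_at_right) auto
    have "((\<lambda>r. y r u) \<longlongrightarrow> y u u) (at u within {u..T})"
      using y st \<rho> by (intro holder_at_imp_tendsto[where a="\<alpha> - \<gamma>"]) (auto simp: volterra_paths_def)
    then have l1: "((\<lambda>r. y r u) \<longlongrightarrow> y u u) (at_right u)" using sub tendsto_mono by blast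
    have "continuous_on {u..T} (\<lambda>r. y r s)"
      using y st by (intro holder_on_imp_continuous_on[where a=1 and S="{s<..T}"]) (auto simp: volterra_paths_def)
    then have "((\<lambda>r. y r s) \<longlongrightarrow> y u s) (at u within {u..T})"
      using st by (auto simp: continuous_on_def)
    then have l2: "((\<lambda>r. y r s) \<longlongrightarrow> y u s) (at_right u)" using sub tendsto_mono by blast
    have lhs: "((\<lambda>r. norm ((y v u - y v s) - (y r u - y r s))) \<longlongrightarrow>
        norm ((y v u - y v s) - (y u u - y u s))) (at_right u)"
      by (intro tendsto_intros l1 l2)
    have "((\<lambda>r. M * (v - u) powr \<zeta> - M * (r - u) powr \<zeta>) \<longlongrightarrow>
        M * (v - u) powr \<zeta> - M * (u - u) powr \<zeta>) (at_right u)"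
      using \<zeta> by (intro tendsto_intros) (auto simp: eventually_at_right_less eventually_at_filter)
    moreover have "\<forall>\<^sub>F r in at_right u.
        norm ((y v u - y v s) - (y r u - y r s)) \<le> M * (v - u) powr \<zeta> - M * (r - u) powr \<zeta>"
      using 3 rv interior by (auto simp: eventually_at_right[OF \<open>u < v\<close>])
    ultimately have "norm ((y v u - y v s) - (y u u - y u s)) \<le> M * (v - u) powr \<zeta> - M * (u - u) powr \<zeta>"
      by (intro tendsto_le[OF trivial_limit_at_right_real _ lhs])
    then show ?thesis using 3 by simp
  qed
qed

text \<open>The first bound in the norm blows up as \<open>r\<close> approaches
  \<open>\<tau>\<close>, and the second does not shrink with \<open>r - u\<close>. They are combined
  by splitting at the midpoint of \<open>u\<close> and \<open>\<tau>\<close>; the factor 2 covers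
  \<open>2 powr \<gamma>\<close> and \<open>2 powr \<alpha>\<close>.\<close>

lemma volterra_left_factor_le:
  assumes z: "z \<in> volterra_paths T \<alpha> \<gamma>" and par: "0 < \<alpha>" "\<alpha> < 1" "0 < \<gamma>" "\<gamma> < 1"
    and st: "0 \<le> u" "t < \<tau>" "\<tau> \<le> T" and r: "r \<in> {u..t}"
  shows "norm (z \<tau> r - z \<tau> u) \<le> 2 * volterra_norm1 T \<alpha> \<gamma> z * (\<tau> - u) powr (-\<gamma>) * (t - u) powr \<alpha>"
proof (cases "r = u")
  case True
  then show ?thesis using volterra_norm1_nonneg[OF z] st r by simp
next
  case False
  with r have r: "u < r" "r \<le> t" by auto
  have A: "volterra_norm1 T \<alpha> \<gamma> z \<ge> 0" using volterra_norm1_nonneg[OF z] st r by simp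
  have two: "2 powr a \<le> 2" if "a < 1" for a :: real
    using powr_mono[of a 1 2] that by simp
  have "min ((\<tau> - r) powr (-\<gamma>) * (r - u) powr \<alpha>) ((\<tau> - u) powr (\<alpha> - \<gamma>))
      \<le> 2 * ((\<tau> - u) powr (-\<gamma>) * (r - u) powr \<alpha>)"
  proof (cases "r - u \<le> (\<tau> - u) / 2")
    case True
    have "(\<tau> - r) powr (-\<gamma>) \<le> ((\<tau> - u) / 2) powr (-\<gamma>)"
      using True par r st by (intro powr_mono2') auto
    also have "\<dots> = 2 powr \<gamma> * (\<tau> - u) powr (-\<gamma>)"
      using r st by (simp add: powr_divide powr_minus divide_simps)
    also have "\<dots> \<le> 2 * (\<tau> - u) powr (-\<gamma>)" using two par by (intro mult_right_mono) auto
    finally have "(\<tau> - r) powr (-\<gamma>) * (r - u) powr \<alpha> \<le> 2 * (\<tau> - u) powr (-\<gamma>) * (r - u) powr \<alpha>"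
      by (intro mult_right_mono) auto
    then show ?thesis by (simp add: mult.assoc)
  next
    case False
    \<comment> \<open>Beyond the midpoint \<open>\<tau> - u\<close> is less than
      \<open>2 * (r - u)\<close>, so its positive power can be traded for one of
      \<open>r - u\<close>.\<close>
    have "(\<tau> - u) powr (\<alpha> - \<gamma>) = (\<tau> - u) powr (-\<gamma>) * (\<tau> - u) powr \<alpha>"
      by (simp add: powr_add[symmetric])
    also have "\<dots> \<le> (\<tau> - u) powr (-\<gamma>) * (2 * (r - u)) powr \<alpha>"
      using False par r st by (intro mult_left_mono powr_mono2) auto
    also have "\<dots> = (\<tau> - u) powr (-\<gamma>) * (2 powr \<alpha> * (r - u) powr \<alpha>)"
      using r by (subst powr_mult) auto
    also have "\<dots> \<le> (\<tau> - u) powr (-\<gamma>) * (2 * (r - u) powr \<alpha>)"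
      using two par by (intro mult_left_mono mult_right_mono) auto
    finally show ?thesis by (simp add: algebra_simps)
  qed
  also have "\<dots> \<le> 2 * ((\<tau> - u) powr (-\<gamma>) * (t - u) powr \<alpha>)"
    using r par by (intro mult_left_mono powr_mono2) auto
  finally have "volterra_norm1 T \<alpha> \<gamma> z * min ((\<tau> - r) powr (-\<gamma>) * (r - u) powr \<alpha>) ((\<tau> - u) powr (\<alpha> - \<gamma>))
      \<le> volterra_norm1 T \<alpha> \<gamma> z * (2 * ((\<tau> - u) powr (-\<gamma>) * (t - u) powr \<alpha>))"
    using A by (rule mult_left_mono)
  moreover have "norm (z \<tau> r - z \<tau> u) \<le> volterra_norm1 T \<alpha> \<gamma> z *
      min ((\<tau> - r) powr (-\<gamma>) * (r - u) powr \<alpha>) ((\<tau> - u) powr (\<alpha> - \<gamma>))"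
    using st r by (intro volterra_norm1_bound[OF z]) auto
  ultimately show ?thesis by (simp add: algebra_simps)
qed


section \<open>The convolution product\<close>

lemma banach_tensor_product_contractive_bilinear:
  assumes "banach_tensor_product tens"
  shows "contractive_bilinear tens"
proof
  have "bilinear tens" using assms by (simp add: banach_tensor_product_def)
  note b = bilinear_ladd[OF this] bilinear_radd[OF this] bilinear_lmul[OF this] bilinear_rmul[OF this]
  show le: "norm (tens a b) \<le> norm a * norm b" for a b
    using assms by (simp add: banach_tensor_product_def)
  show "tens (a + a') b = tens a b + tens a' b" "tens a (b + b') = tens a b + tens a b'"
    "tens (r *\<^sub>R a) b = r *\<^sub>R tens a b" "tens a (r *\<^sub>R b) = r *\<^sub>R tens a b" for a a' b b' r
    by (simp_all add: b)
  show "\<exists>K. \<forall>a b. norm (tens a b) \<le> norm a * norm b * K"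
    using le by (intro exI[of _ 1]) simp
qed

context contractive_bilinear
begin

text \<open>Abel summation: on each interval the increment of the product of \<open>F\<close> and
  \<open>g\<close> splits into a left-point and a right-point term. Normalising \<open>F\<close> to
  vanish at \<open>u\<close> removes the lower boundary term.\<close>

lemma convolution_sum_by_parts:
  assumes "P division_of {u..t}" "u \<le> t"
  shows "convolution_sum tens z y s u \<tau> P = tens (z \<tau> t - z \<tau> u) (y t u - y t s)
     - stieltjes_sum tens (\<lambda>r. z \<tau> r - z \<tau> u) (\<lambda>r. y r u - y r s) P"
proof -
  let ?h = "\<lambda>r. tens (z \<tau> r - z \<tau> u) (y r u - y r s)"
  have "convolution_sum tens z y s u \<tau> P
      + stieltjes_sum tens (\<lambda>r. z \<tau> r - z \<tau> u) (\<lambda>r. y r u - y r s) P = (\<Sum>K\<in>P. ?h (Sup K) - ?h (Inf K))"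
    unfolding convolution_sum_def stieltjes_sum_def sum.distrib[symmetric]
    by (intro sum.cong refl) (simp add: diff_left diff_right)
  also have "\<dots> = ?h t - ?h u" by (rule division_telescope[OF assms])
  finally show ?thesis by (simp add: zero_left algebra_simps)
qed

lemma convolution_sum_lincomb_left:
  "convolution_sum tens (\<lambda>r v. a *\<^sub>R z1 r v + b *\<^sub>R z2 r v) y s u \<tau> =
   (\<lambda>P. a *\<^sub>R convolution_sum tens z1 y s u \<tau> P + b *\<^sub>R convolution_sum tens z2 y s u \<tau> P)"
  unfolding convolution_sum_def scaleR_sum_right sum.distrib[symmetric]
  by (intro ext sum.cong refl) (simp add: add_left diff_left scaleR_left algebra_simps)

lemma convolution_sum_lincomb_right:
  "convolution_sum tens z (\<lambda>r v. a *\<^sub>R y1 r v + b *\<^sub>R y2 r v) s u \<tau> =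
   (\<lambda>P. a *\<^sub>R convolution_sum tens z y1 s u \<tau> P + b *\<^sub>R convolution_sum tens z y2 s u \<tau> P)"
  unfolding convolution_sum_def scaleR_sum_right sum.distrib[symmetric]
  by (intro ext sum.cong refl) (simp add: add_right diff_right scaleR_right algebra_simps)

end

section \<open>Existence of the convolution and its bound\<close>

lemma convolution_eqI:
  "(convolution_sum tens z y s u \<tau> \<longlongrightarrow> L) (mesh_filter u t) \<Longrightarrow> convolution tens z y s u t \<tau> = L"
  unfolding convolution_def by (rule tendsto_Lim[OF mesh_filter_neq_bot])

lemma convolution_tendsto:
  fixes tens :: "'a::banach \<Rightarrow> 'a \<Rightarrow> 'b::banach"
  assumes tens: "banach_tensor_product tens"
    and z: "z \<in> volterra_paths T \<alpha> \<gamma>" and \<alpha>: "0 < \<alpha>"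
    and y: "y \<in> volterra_paths T \<alpha>' \<gamma>'" and \<rho>': "0 < \<alpha>' - \<gamma>'" "\<alpha>' - \<gamma>' < 1"
    and st: "0 \<le> s" "s < u" "u < t" "t < \<tau>" "\<tau> \<le> T"
  shows "(convolution_sum tens z y s u \<tau> \<longlongrightarrow> convolution tens z y s u t \<tau>) (mesh_filter u t)"
proof -
  interpret contractive_bilinear tens
    using tens by (rule banach_tensor_product_contractive_bilinear)
  let ?F = "\<lambda>r. z \<tau> r - z \<tau> u" and ?g = "\<lambda>r. y r u - y r s"
  \<comment> \<open>As \<open>t < \<tau>\<close>, the interval is a compact part of
    \<open>{0..<\<tau>}\<close>, where the local Hoelder condition gives continuity.\<close>
  have "continuous_on {u..t} (\<lambda>r. z \<tau> r)"
    using z st \<alpha> by (intro holder_on_imp_continuous_on[where a=\<alpha> and S="{0..<\<tau>}"]) (auto simp: volterra_paths_def)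
  then have F: "continuous_on {u..t} ?F" by (intro continuous_intros)
  have "cauchy_filter (filtermap (stieltjes_sum tens ?F ?g) (mesh_filter u t))"
    using st by (intro stieltjes_sum_Cauchy[OF _ F volterra_right_factor[OF y \<rho>']]) auto
  then obtain L where L: "(stieltjes_sum tens ?F ?g \<longlongrightarrow> L) (mesh_filter u t)"
    using cauchy_filter_imp_tendsto mesh_filter_neq_bot by blast
  have "((\<lambda>P. tens (?F t) (?g t) - stieltjes_sum tens ?F ?g P) \<longlongrightarrow> tens (?F t) (?g t) - L) (mesh_filter u t)"
    by (intro tendsto_intros L)
  moreover have "\<forall>\<^sub>F P in mesh_filter u t.
      convolution_sum tens z y s u \<tau> P = tens (?F t) (?g t) - stieltjes_sum tens ?F ?g P"
    unfolding eventually_mesh_filter using convolution_sum_by_parts st by (intro exI[of _ 1]) auto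
  ultimately have "(convolution_sum tens z y s u \<tau> \<longlongrightarrow> tens (?F t) (?g t) - L) (mesh_filter u t)"
    by (simp add: tendsto_cong)
  then show ?thesis using convolution_eqI by metis
qed

text \<open>The bound holds for every partition and passes to the limit. The first norm of
  \<open>y\<close> controls the boundary term and the second the Stieltjes sum, whence their sum on
  the right.\<close>

lemma norm_convolution_le:
  fixes tens :: "'a::banach \<Rightarrow> 'a \<Rightarrow> 'b::banach"
  assumes tens: "banach_tensor_product tens"
    and z: "z \<in> volterra_paths T \<alpha> \<gamma>" and par: "0 < \<alpha>" "\<alpha> < 1" "0 < \<gamma>" "\<gamma> < 1"
    and y: "y \<in> volterra_paths T \<alpha>' \<gamma>'" and \<rho>': "0 < \<alpha>' - \<gamma>'" "\<alpha>' - \<gamma>' < 1"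
    and st: "0 \<le> s" "s < u" "u < t" "t < \<tau>" "\<tau> \<le> T"
  shows "norm (convolution tens z y s u t \<tau>) \<le>
    2 * (1 + weight_const ((\<alpha>' - \<gamma>') / 2)) * volterra_norm1 T \<alpha> \<gamma> z * volterra_norm T \<alpha>' \<gamma>' y *
      ((\<tau> - u) powr (-\<gamma>) * (t - u) powr \<alpha> * (t - s) powr (\<alpha>' - \<gamma>'))"
proof -
  interpret contractive_bilinear tens
    using tens by (rule banach_tensor_product_contractive_bilinear)
  let ?F = "\<lambda>r. z \<tau> r - z \<tau> u" and ?g = "\<lambda>r. y r u - y r s"
  define \<zeta> where "\<zeta> = (\<alpha>' - \<gamma>') / 2"
  define c where "c = weight_const \<zeta>"
  define A where "A = volterra_norm1 T \<alpha> \<gamma> z"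
  define B1 where "B1 = volterra_norm1 T \<alpha>' \<gamma>' y"
  define B2 where "B2 = volterra_norm12 T \<alpha>' \<gamma>' y"
  define X where "X = 2 * A * (\<tau> - u) powr (-\<gamma>) * (t - u) powr \<alpha>"
  define D where "D = (t - s) powr (\<alpha>' - \<gamma>')"
  define G where "G r = B2 * c * (t - s) powr \<zeta> * (r - u) powr \<zeta>" for r
  have "\<zeta> > 0" using \<rho>' by (simp add: \<zeta>_def)
  have "T > 0" using st by simp
  have nn: "A \<ge> 0" "B1 \<ge> 0" "B2 \<ge> 0" "c \<ge> 0" "D \<ge> 0"
    using volterra_norm1_nonneg[OF z] volterra_norm1_nonneg[OF y] volterra_norm12_nonneg[OF y]
      \<rho>' \<open>T > 0\<close> weight_const_pos[OF \<open>\<zeta> > 0\<close>]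
    by (auto simp: A_def B1_def B2_def c_def D_def)
  then have "X \<ge> 0" by (simp add: X_def)
  have F: "norm (?F r) \<le> X" if "r \<in> {u..t}" for r
    unfolding X_def A_def using st that by (intro volterra_left_factor_le[OF z par]) auto
  have g: "norm (?g v - ?g r) \<le> G v - G r" if "u \<le> r" "r \<le> v" "v \<le> t" for r v
    unfolding G_def B2_def c_def \<zeta>_def using st that by (intro volterra_right_factor[OF y \<rho>']) auto
  have "norm (?g t) \<le> B1 * min ((t - u) powr (-\<gamma>') * (u - s) powr \<alpha>') ((t - s) powr (\<alpha>' - \<gamma>'))"
    unfolding B1_def using st by (intro volterra_norm1_bound[OF y]) auto
  also have "\<dots> \<le> B1 * D" unfolding D_def using nn by (intro mult_left_mono) auto
  finally have gt: "norm (?g t) \<le> B1 * D" .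
  \<comment> \<open>\<open>G u\<close> vanishes because \<open>0 powr \<zeta> = 0\<close>. Enlarging
    \<open>t - u\<close> to \<open>t - s\<close> lets the two half powers recombine to
    \<open>\<alpha>' - \<gamma>'\<close>.\<close>
  have "G t - G u = B2 * c * ((t - s) powr \<zeta> * (t - u) powr \<zeta>)" by (simp add: G_def)
  also have "\<dots> \<le> B2 * c * ((t - s) powr \<zeta> * (t - s) powr \<zeta>)"
    using nn st \<open>\<zeta> > 0\<close> by (intro mult_left_mono powr_mono2) auto
  also have "\<dots> = B2 * c * D" by (simp add: D_def \<zeta>_def powr_add[symmetric])
  finally have Gt: "G t - G u \<le> B2 * c * D" .
  have "norm (convolution_sum tens z y s u \<tau> P) \<le> X * ((1 + c) * (B1 + B2) * D)"
    if P: "P division_of {u..t}" for P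
  proof -
    have "norm (convolution_sum tens z y s u \<tau> P) \<le> norm (tens (?F t) (?g t)) + norm (stieltjes_sum tens ?F ?g P)"
      using st by (simp add: convolution_sum_by_parts[OF P] norm_triangle_ineq4)
    also have "\<dots> \<le> norm (?F t) * norm (?g t) + X * (G t - G u)"
      using st by (intro add_mono norm_tens_le norm_stieltjes_sum_le[OF P _ F g]) auto
    also have "\<dots> \<le> X * (B1 * D) + X * (B2 * c * D)"
      using F[of t] gt Gt \<open>X \<ge> 0\<close> st by (intro add_mono mult_mono mult_left_mono) auto
    also have "\<dots> \<le> X * ((1 + c) * (B1 + B2) * D)"
    proof -
      \<comment> \<open>The nonnegative cross terms are added to factor out the full norm of
        \<open>y\<close>.\<close>
      have "B1 * D + B2 * c * D + (B2 * D + B1 * c * D) = (1 + c) * (B1 + B2) * D"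
        by (simp add: algebra_simps)
      moreover have "0 \<le> B2 * D + B1 * c * D" using nn by simp
      ultimately show ?thesis
        using \<open>X \<ge> 0\<close> by (simp add: distrib_left[symmetric] mult_left_mono)
    qed
    finally show ?thesis .
  qed
  then have "norm (convolution tens z y s u t \<tau>) \<le> X * ((1 + c) * (B1 + B2) * D)"
    by (intro tendsto_upperbound[OF tendsto_norm[OF convolution_tendsto[OF tens z par(1) y \<rho>' st]] _ mesh_filter_neq_bot])
       (auto simp: eventually_mesh_filter intro!: exI[of _ 1])
  also have "\<dots> = 2 * (1 + c) * A * (B1 + B2) * ((\<tau> - u) powr (-\<gamma>) * (t - u) powr \<alpha> * D)"
    by (simp only: X_def mult_ac)
  finally show ?thesis
    by (simp only: A_def B1_def B2_def c_def D_def \<zeta>_def volterra_norm_def)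
qed

lemma convolution_weight_le:
  fixes \<alpha> \<gamma> \<rho>' :: real
  assumes "0 < \<alpha>" "0 < \<gamma>" "0 < \<alpha> - \<gamma>" "0 < \<rho>'" and st: "s < u" "u < t" "t < \<tau>"
  shows "(\<tau> - u) powr (-\<gamma>) * (t - u) powr \<alpha> * (t - s) powr \<rho>' \<le>
    min ((\<tau> - t) powr (-\<gamma>) * (t - s) powr ((\<alpha> - \<gamma>) + \<rho>' + \<gamma>)) ((\<tau> - s) powr ((\<alpha> - \<gamma>) + \<rho>'))"
proof (rule min.boundedI)
  have "(\<tau> - u) powr (-\<gamma>) * (t - u) powr \<alpha> * (t - s) powr \<rho>'
      \<le> (\<tau> - t) powr (-\<gamma>) * (t - s) powr \<alpha> * (t - s) powr \<rho>'"
    using assms by (intro mult_right_mono mult_mono powr_mono2 powr_mono2') auto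
  also have "\<dots> = (\<tau> - t) powr (-\<gamma>) * (t - s) powr ((\<alpha> - \<gamma>) + \<rho>' + \<gamma>)"
    by (simp add: mult.assoc powr_add[symmetric])
  finally show "(\<tau> - u) powr (-\<gamma>) * (t - u) powr \<alpha> * (t - s) powr \<rho>'
      \<le> (\<tau> - t) powr (-\<gamma>) * (t - s) powr ((\<alpha> - \<gamma>) + \<rho>' + \<gamma>)" .
  \<comment> \<open>The negative power is absorbed into a positive one before
    \<open>\<tau> - u\<close> is enlarged to \<open>\<tau> - s\<close>, since enlarging the base of
    a negative power would go the wrong way.\<close>
  have "(\<tau> - u) powr (-\<gamma>) * (t - u) powr \<alpha> * (t - s) powr \<rho>'
      \<le> (\<tau> - u) powr (-\<gamma>) * (\<tau> - u) powr \<alpha> * (t - s) powr \<rho>'"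
    using assms by (intro mult_right_mono mult_left_mono powr_mono2) auto
  also have "\<dots> = (\<tau> - u) powr (\<alpha> - \<gamma>) * (t - s) powr \<rho>'"
    by (simp add: powr_add[symmetric])
  also have "\<dots> \<le> (\<tau> - s) powr (\<alpha> - \<gamma>) * (\<tau> - s) powr \<rho>'"
    using assms by (intro mult_mono powr_mono2) auto
  also have "\<dots> = (\<tau> - s) powr ((\<alpha> - \<gamma>) + \<rho>')" by (simp add: powr_add[symmetric])
  finally show "(\<tau> - u) powr (-\<gamma>) * (t - u) powr \<alpha> * (t - s) powr \<rho>' \<le> (\<tau> - s) powr ((\<alpha> - \<gamma>) + \<rho>')" .
qed

theorem theorem26:
  fixes T \<alpha> \<gamma> \<alpha>' \<gamma>' :: real
    and tens :: "'a::banach \<Rightarrow> 'a \<Rightarrow> 'b::banach"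
  assumes "T > 0"
    and "\<alpha> \<in> {0<..<1}" "\<gamma> \<in> {0<..<1}" "\<alpha>' \<in> {0<..<1}" "\<gamma>' \<in> {0<..<1}"
    and "\<alpha> - \<gamma> > 0" "\<alpha>' - \<gamma>' > 0"
    and "banach_tensor_product tens"
  shows
    "(\<forall>z\<in>volterra_paths T \<alpha> \<gamma>. \<forall>y\<in>volterra_paths T \<alpha>' \<gamma>'. \<forall>s u t \<tau>.
        [s, u, t, \<tau>] \<in> time_simplex 4 T \<longrightarrow>
        (\<exists>L. (convolution_sum tens z y s u \<tau> \<longlongrightarrow> L) (mesh_filter u t)))
   \<and> (\<forall>z1\<in>volterra_paths T \<alpha> \<gamma>. \<forall>z2\<in>volterra_paths T \<alpha> \<gamma>. \<forall>y\<in>volterra_paths T \<alpha>' \<gamma>'.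
        \<forall>(a::real) b s u t \<tau>. [s, u, t, \<tau>] \<in> time_simplex 4 T \<longrightarrow>
        convolution tens (\<lambda>r v. a *\<^sub>R z1 r v + b *\<^sub>R z2 r v) y s u t \<tau> =
        a *\<^sub>R convolution tens z1 y s u t \<tau> + b *\<^sub>R convolution tens z2 y s u t \<tau>)
   \<and> (\<forall>z\<in>volterra_paths T \<alpha> \<gamma>. \<forall>y1\<in>volterra_paths T \<alpha>' \<gamma>'. \<forall>y2\<in>volterra_paths T \<alpha>' \<gamma>'.
        \<forall>(a::real) b s u t \<tau>. [s, u, t, \<tau>] \<in> time_simplex 4 T \<longrightarrow>
        convolution tens z (\<lambda>r v. a *\<^sub>R y1 r v + b *\<^sub>R y2 r v) s u t \<tau> =
        a *\<^sub>R convolution tens z y1 s u t \<tau> + b *\<^sub>R convolution tens z y2 s u t \<tau>)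
   \<and> (\<exists>C>0. \<forall>z\<in>volterra_paths T \<alpha> \<gamma>. \<forall>y\<in>volterra_paths T \<alpha>' \<gamma>'. \<forall>s u t \<tau>.
        [s, u, t, \<tau>] \<in> time_simplex 4 T \<longrightarrow>
        norm (convolution tens z y s u t \<tau>) \<le>
          C * volterra_norm1 T \<alpha> \<gamma> z * volterra_norm T \<alpha>' \<gamma>' y *
          min ((\<tau> - t) powr (-\<gamma>) * (t - s) powr ((\<alpha> - \<gamma>) + (\<alpha>' - \<gamma>') + \<gamma>))
              ((\<tau> - s) powr ((\<alpha> - \<gamma>) + (\<alpha>' - \<gamma>'))))"
proof -
  interpret contractive_bilinear tens
    using assms(8) by (rule banach_tensor_product_contractive_bilinear)
  have par: "0 < \<alpha>" "\<alpha> < 1" "0 < \<gamma>" "\<gamma> < 1" and \<rho>': "0 < \<alpha>' - \<gamma>'" "\<alpha>' - \<gamma>' < 1"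
    using assms by auto
  \<comment> \<open>This depends on the exponents of \<open>y\<close> alone, hence is uniform in the
    paths and the times.\<close>
  define C where "C = 2 * (1 + weight_const ((\<alpha>' - \<gamma>') / 2))"
  have "C > 0" using weight_const_pos[of "(\<alpha>' - \<gamma>') / 2"] \<rho>' by (simp add: C_def)
  have lim: "(convolution_sum tens z y s u \<tau> \<longlongrightarrow> convolution tens z y s u t \<tau>) (mesh_filter u t)"
    if "z \<in> volterra_paths T \<alpha> \<gamma>" "y \<in> volterra_paths T \<alpha>' \<gamma>'" "[s, u, t, \<tau>] \<in> time_simplex 4 T"
    for z y s u t \<tau>
    using that(3) unfolding time_simplex_4
    by (intro convolution_tendsto[OF assms(8) that(1) par(1) that(2) \<rho>']) auto
  have bound: "norm (convolution tens z y s u t \<tau>) \<le>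
          C * volterra_norm1 T \<alpha> \<gamma> z * volterra_norm T \<alpha>' \<gamma>' y *
          min ((\<tau> - t) powr (-\<gamma>) * (t - s) powr ((\<alpha> - \<gamma>) + (\<alpha>' - \<gamma>') + \<gamma>))
              ((\<tau> - s) powr ((\<alpha> - \<gamma>) + (\<alpha>' - \<gamma>')))"
    if z: "z \<in> volterra_paths T \<alpha> \<gamma>" and y: "y \<in> volterra_paths T \<alpha>' \<gamma>'"
      and st: "[s, u, t, \<tau>] \<in> time_simplex 4 T" for z y s u t \<tau>
  proof -
    have "C * volterra_norm1 T \<alpha> \<gamma> z * volterra_norm T \<alpha>' \<gamma>' y \<ge> 0"
      using volterra_norm1_nonneg[OF z] volterra_norm1_nonneg[OF y] volterra_norm12_nonneg[OF y]
        \<rho>' \<open>T > 0\<close> \<open>C > 0\<close> by (simp add: volterra_norm_def)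
    then show ?thesis
      using norm_convolution_le[OF assms(8) z par y \<rho>', of s u t \<tau>] st par \<rho>' assms(6)
      unfolding time_simplex_4 C_def[symmetric]
      by (intro order_trans[OF _ mult_left_mono[OF convolution_weight_le]]) auto
  qed
  show ?thesis
  proof (intro conjI ballI allI impI)
    fix z y :: "real \<Rightarrow> real \<Rightarrow> 'a" and s u t \<tau> :: real
    assume "z \<in> volterra_paths T \<alpha> \<gamma>" "y \<in> volterra_paths T \<alpha>' \<gamma>'" "[s, u, t, \<tau>] \<in> time_simplex 4 T"
    then show "\<exists>L. (convolution_sum tens z y s u \<tau> \<longlongrightarrow> L) (mesh_filter u t)" using lim by blast
  next
    fix z1 z2 y :: "real \<Rightarrow> real \<Rightarrow> 'a" and a b s u t \<tau> :: real
    assume "z1 \<in> volterra_paths T \<alpha> \<gamma>" "z2 \<in> volterra_paths T \<alpha> \<gamma>" "y \<in> volterra_paths T \<alpha>' \<gamma>'"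
      "[s, u, t, \<tau>] \<in> time_simplex 4 T"
    \<comment> \<open>Linearity holds for each finite sum; the limit of the combination is computed
      from the two individual limits.\<close>
    then show "convolution tens (\<lambda>r v. a *\<^sub>R z1 r v + b *\<^sub>R z2 r v) y s u t \<tau> =
        a *\<^sub>R convolution tens z1 y s u t \<tau> + b *\<^sub>R convolution tens z2 y s u t \<tau>"
      by (intro convolution_eqI, unfold convolution_sum_lincomb_left, intro tendsto_intros lim)
  next
    fix z y1 y2 :: "real \<Rightarrow> real \<Rightarrow> 'a" and a b s u t \<tau> :: real
    assume "z \<in> volterra_paths T \<alpha> \<gamma>" "y1 \<in> volterra_paths T \<alpha>' \<gamma>'" "y2 \<in> volterra_paths T \<alpha>' \<gamma>'"
      "[s, u, t, \<tau>] \<in> time_simplex 4 T"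
    then show "convolution tens z (\<lambda>r v. a *\<^sub>R y1 r v + b *\<^sub>R y2 r v) s u t \<tau> =
        a *\<^sub>R convolution tens z y1 s u t \<tau> + b *\<^sub>R convolution tens z y2 s u t \<tau>"
      by (intro convolution_eqI, unfold convolution_sum_lincomb_right, intro tendsto_intros lim)
  next
    show "\<exists>C>0. \<forall>z\<in>volterra_paths T \<alpha> \<gamma>. \<forall>y\<in>volterra_paths T \<alpha>' \<gamma>'. \<forall>s u t \<tau>.
        [s, u, t, \<tau>] \<in> time_simplex 4 T \<longrightarrow>
        norm (convolution tens z y s u t \<tau>) \<le>
          C * volterra_norm1 T \<alpha> \<gamma> z * volterra_norm T \<alpha>' \<gamma>' y *
          min ((\<tau> - t) powr (-\<gamma>) * (t - s) powr ((\<alpha> - \<gamma>) + (\<alpha>' - \<gamma>') + \<gamma>))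
              ((\<tau> - s) powr ((\<alpha> - \<gamma>) + (\<alpha>' - \<gamma>')))"
      using \<open>C > 0\<close> bound by blast
  qed
qed

end
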